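(* Let $\mathfrak{A}$ be an index set containing at least two elements, let $\mathcal{Z}\in\Lambda$, and let $(\mathcal{X}_\alpha)_{\alpha\in\mathfrak{A}}$ be a family in $\Lambda$ consisting of $\sigma$-fields that are conditionally independent given $\mathcal{Z}$. Then $$\mathcal{Z}=\land_{\alpha\in\mathfrak{A}}(\mathcal{X}_\alpha\lor\mathcal{Z});$$ in particular $\land_{\alpha\in\mathfrak{A}}\mathcal{X}_\alpha\subset\mathcal{Z}$.
   Context: $(\Omega,\mathcal{M},\mathbb{P})$ is a probability space ($\mathbb{P}$ itself need not be complete). $0_\Lambda:=\mathbb{P}^{-1}(\{0,1\})$ is the collection of all events of $\mathcal{M}$ having probability $0$ or $1$. A sub-$\sigma$-field of $\mathcal{M}$ is called complete if it contains $0_\Lambda$, and $\Lambda$ denotes the collection of all complete sub-$\sigma$-fields of $\mathcal{M}$. For $\mathcal{X},\mathcal{Y}\in\Lambda$, $\mathcal{X}\lor\mathcal{Y}:=\sigma(\mathcal{X}\cup\mathcal{Y})$. For a non-empty family $(\mathcal{X}_t)_{t\in T}$ in $\Lambda$, $\land_{t\in T}\mathcal{X}_t:=\cap_{t\in T}\mathcal{X}_t$. Index sets are arbitrary. Conditional independence of a family of $\sigma$-fields means mutual conditional independence, under $\mathbb{P}$, of every finite subfamily. *)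

theory Defs
  imports "HOL-Probability.Probability"
begin

text \<open>Sub-\<open>\<sigma>\<close>-fields of \<open>M\<close> are represented by their collections of events, so that
  equality and inclusion of \<open>\<sigma>\<close>-fields are equality and inclusion of sets, and the meet
  of a non-empty family is its intersection.\<close>

definition trivial_events :: "'a measure \<Rightarrow> 'a set set"  (* $0_\Lambda = P^{-1}(\{0,1\})$ *)
  where "trivial_events M = {A \<in> sets M. measure M A \<in> {0, 1}}"

definition complete_subfields :: "'a measure \<Rightarrow> 'a set set set"  (* $\Lambda$ *)
  where "complete_subfields M =
    {X. sigma_algebra (space M) X \<and> X \<subseteq> sets M \<and> trivial_events M \<subseteq> X}"

definition field_join :: "'a measure \<Rightarrow> 'a set set \<Rightarrow> 'a set set \<Rightarrow> 'a set set"
  where "field_join M X Y = sigma_sets (space M) (X \<union> Y)"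

text \<open>Conditional probability of \<open>A\<close> given \<open>Z\<close>, in a fixed version.
  For a \<open>\<sigma>\<close>-field \<open>Z\<close> on \<open>space M\<close> we have \<open>sets (sigma (space M) Z) = Z\<close>; the
  conditional expectation depends on its second argument only through its space and sets.\<close>

definition cond_prob_given :: "'a measure \<Rightarrow> 'a set set \<Rightarrow> 'a set \<Rightarrow> 'a \<Rightarrow> real"
  where "cond_prob_given M Z A = real_cond_exp M (sigma (space M) Z) (indicator A)"

text \<open>The conditional analogue of \<open>prob_space.indep_sets\<close>.\<close>

definition cond_indep_fields ::
    "'a measure \<Rightarrow> 'a set set \<Rightarrow> ('i \<Rightarrow> 'a set set) \<Rightarrow> 'i set \<Rightarrow> bool"
  where "cond_indep_fields M Z X I \<longleftrightarrow>
    (\<forall>J\<subseteq>I. J \<noteq> {} \<longrightarrow> finite J \<longrightarrow>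
      (\<forall>A\<in>Pi J X. AE w in M.
        cond_prob_given M Z (\<Inter>j\<in>J. A j) w = (\<Prod>j\<in>J. cond_prob_given M Z (A j) w)))"

end

(* An event A lying in two of the joins is conditionally independent of itself given Z, so
   P(A|Z) = P(A|Z)^2 almost surely; hence A agrees up to a null set with the Z-measurable event
   {P(A|Z) = 1}, and by completeness A belongs to Z. *)

theory Submission
  imports Defs
begin

section \<open>Comparing set integrals on generated sigma-fields and on joins\<close>

text \<open>Dynkin's pi-lambda argument: the events over which \<open>f\<close> and \<open>g\<close>
  have equal integrals are closed under complements and countable disjoint unions. The complement
  step needs equal total integrals, which \<open>space M \<in> G\<close> supplies.\<close>

lemma set_integral_eq_on_sigma_sets:
  fixes f g :: "'a \<Rightarrow> real"
  assumes f: "integrable M f" and g: "integrable M g"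
    and "Int_stable G" and G: "G \<subseteq> sets M" and "space M \<in> G"
    and eq: "\<And>A. A \<in> G \<Longrightarrow> (\<integral>x\<in>A. f x \<partial>M) = (\<integral>x\<in>A. g x \<partial>M)"
    and "A \<in> sigma_sets (space M) G"
  shows "(\<integral>x\<in>A. f x \<partial>M) = (\<integral>x\<in>A. g x \<partial>M)"
proof -
  have meas: "A \<in> sets M" if "A \<in> sigma_sets (space M) G" for A
    using sets.sigma_sets_subset[OF G] that by blast
  have int: "set_integrable M A f" "set_integrable M A g" if "A \<in> sets M" for A
    using f g that unfolding set_integrable_def by (blast intro: integrable_mult_indicator)+
  have "G \<subseteq> Pow (space M)"
    using G sets.space_closed by blast
  from \<open>Int_stable G\<close> this \<open>A \<in> sigma_sets (space M) G\<close> show ?thesis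
  proof (induction rule: sigma_sets_induct_disjoint)
    case (basic A)
    then show ?case by (rule eq)
  next
    case empty
    show ?case by (simp add: set_lebesgue_integral_def)
  next
    case (compl A)
    have A: "A \<in> sets M" "space M - A \<in> sets M"
      using meas[OF compl.hyps] by auto
    have "(\<integral>x\<in>space M - A. h x \<partial>M) = (\<integral>x\<in>space M. h x \<partial>M) - (\<integral>x\<in>A. h x \<partial>M)"
      if "integrable M h" for h :: "'a \<Rightarrow> real"
    proof -
      have "set_integrable M A h" "set_integrable M (space M - A) h"
        using that A unfolding set_integrable_def by (blast intro: integrable_mult_indicator)+
      moreover have "A \<union> (space M - A) = space M"
        using sets.sets_into_space[OF A(1)] by blast
      ultimately show ?thesis
        using set_integral_Un[of A "space M - A" M h] by auto
    qed
    then show ?case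
      using compl.IH eq[OF \<open>space M \<in> G\<close>] f g by simp
  next
    case (union A)
    have A: "A i \<in> sets M" for i
      using union.hyps meas by blast
    moreover have "A i \<inter> A j = {}" if "i \<noteq> j" for i j
      using \<open>disjoint_family A\<close> that by (auto simp: disjoint_family_on_def)
    \<comment> \<open>Integrability over the whole union turns both integrals into series whose
      terms agree by induction.\<close>
    ultimately show ?case
      using union.IH int[of "\<Union>i. A i"] by (simp add: lebesgue_integral_countable_add)
  qed
qed

text \<open>The rectangles \<open>A \<inter> C\<close> form a pi-system whose generated sigma-field
  includes the join, so checking them is enough.\<close>

lemma set_integral_eq_on_field_join:
  fixes f g :: "'a \<Rightarrow> real"
  assumes f: "integrable M f" and g: "integrable M g"
    and X: "X \<in> complete_subfields M" and Z: "Z \<in> complete_subfields M"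
    and eq: "\<And>A C. A \<in> X \<Longrightarrow> C \<in> Z \<Longrightarrow> (\<integral>x\<in>A \<inter> C. f x \<partial>M) = (\<integral>x\<in>A \<inter> C. g x \<partial>M)"
    and B: "B \<in> field_join M X Z"
  shows "(\<integral>x\<in>B. f x \<partial>M) = (\<integral>x\<in>B. g x \<partial>M)"
proof (rule set_integral_eq_on_sigma_sets[OF f g])
  let ?G = "{A \<inter> C | A C. A \<in> X \<and> C \<in> Z}"
  interpret X: sigma_algebra "space M" X using X by (simp add: complete_subfields_def)
  interpret Z: sigma_algebra "space M" Z using Z by (simp add: complete_subfields_def)
  have sub: "X \<subseteq> sets M" "Z \<subseteq> sets M"
    using X Z by (auto simp: complete_subfields_def)
  show "Int_stable ?G"
  proof (rule Int_stableI)
    fix S T assume "S \<in> ?G" "T \<in> ?G"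
    then obtain A C A' C' where "A \<in> X" "C \<in> Z" "A' \<in> X" "C' \<in> Z" "S = A \<inter> C" "T = A' \<inter> C'"
      by blast
    then have "A \<inter> A' \<in> X" "C \<inter> C' \<in> Z" "S \<inter> T = (A \<inter> A') \<inter> (C \<inter> C')"
      by auto
    then show "S \<inter> T \<in> ?G" by blast
  qed
  show "?G \<subseteq> sets M"
    using sub by blast
  show "space M \<in> ?G"
    using X.top Z.top by blast
  show "(\<integral>x\<in>A. f x \<partial>M) = (\<integral>x\<in>A. g x \<partial>M)" if "A \<in> ?G" for A
    using that eq by blast
  \<comment> \<open>Intersecting with the whole space, which lies in both fields, makes every member
    of \<open>X\<close> or \<open>Z\<close> a rectangle.\<close>
  have "A \<in> ?G" if "A \<in> X \<union> Z" for A
  proof (cases "A \<in> X")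
    case True
    then have "A = A \<inter> space M" using X.sets_into_space by blast
    then show ?thesis using True Z.top by blast
  next
    case False
    then have "A \<in> Z" using that by blast
    then have "A = space M \<inter> A" using Z.sets_into_space by blast
    then show ?thesis using \<open>A \<in> Z\<close> X.top by blast
  qed
  then have "X \<union> Z \<subseteq> ?G" by blast
  from sigma_sets_mono'[OF this] B show "B \<in> sigma_sets (space M) ?G"
    unfolding field_join_def by (rule subsetD)
qed

lemma field_join_subset_sets:
  assumes "X \<in> complete_subfields M" "Z \<in> complete_subfields M"
  shows "field_join M X Z \<subseteq> sets M"
  using assms unfolding field_join_def complete_subfields_def
  by (intro sets.sigma_sets_subset) auto

lemma field_join_Int_right:
  assumes "X \<in> complete_subfields M" "Z \<in> complete_subfields M"
    and "A \<in> field_join M X Z" "C \<in> Z"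
  shows "A \<inter> C \<in> field_join M X Z"
proof -
  have "X \<union> Z \<subseteq> Pow (space M)"
    using assms(1,2) sets.space_closed unfolding complete_subfields_def by blast
  then interpret J: sigma_algebra "space M" "field_join M X Z"
    unfolding field_join_def by (rule sigma_algebra_sigma_sets)
  have "C \<in> field_join M X Z"
    using \<open>C \<in> Z\<close> unfolding field_join_def by blast
  then show ?thesis using assms(3) by blast
qed

section \<open>Conditional probabilities given a sub-sigma-field\<close>

lemma (in finite_measure_subalgebra) integrable_cond_exp_indicator_mult_indicator:
  assumes "A \<in> sets M" "B \<in> sets M" "C \<in> sets F"
  shows "integrable M
    (\<lambda>x. (indicator C x * real_cond_exp M F (indicator B) x) * (indicator A x :: real))"
proof -
  have "C \<in> sets M"
    using assms(3) subalg by (auto simp: subalgebra_def)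
  have "integrable M (real_cond_exp M F (indicator B))"
    using assms(2) by (intro real_cond_exp_int(1)) (simp add: fmeasurable_eq_sets less_top[symmetric])
  then have "integrable M (\<lambda>x. real_cond_exp M F (indicator B) x * indicator C x * (indicator A x :: real))"
    using \<open>C \<in> sets M\<close> \<open>A \<in> sets M\<close> by (intro integrable_real_mult_indicator)
  then show ?thesis by (simp add: mult_ac)
qed

text \<open>The factor \<open>indicator C x * real_cond_exp M F (indicator B) x\<close> is
  \<open>F\<close>-measurable, so integrating it against the indicator of \<open>A\<close> or
  against its conditional expectation gives the same value. The resulting integral is symmetric in
  \<open>A\<close> and \<open>B\<close>.\<close>

lemma (in finite_measure_subalgebra) cond_exp_indicator_mult:
  assumes A: "A \<in> sets M" and B: "B \<in> sets M" and C: "C \<in> sets F"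
  shows "integrable M (\<lambda>x. indicator C x * real_cond_exp M F (indicator B) x *
      real_cond_exp M F (indicator A) x)"
    and "(\<integral>x\<in>A \<inter> C. real_cond_exp M F (indicator B) x \<partial>M) =
      (\<integral>x. indicator C x * real_cond_exp M F (indicator B) x * real_cond_exp M F (indicator A) x \<partial>M)"
proof -
  let ?f = "\<lambda>x. indicator C x * real_cond_exp M F (indicator B) x"
  have f: "?f \<in> borel_measurable F"
    using C by measurable
  note int = integrable_cond_exp_indicator_mult_indicator[OF A B C]
  show "integrable M (\<lambda>x. ?f x * real_cond_exp M F (indicator A) x)"
    using A by (intro real_cond_exp_intg(1)[OF int f]) simp
  have "(\<integral>x. ?f x * real_cond_exp M F (indicator A) x \<partial>M) = (\<integral>x. ?f x * indicator A x \<partial>M)"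
    using A by (intro real_cond_exp_intg(2)[OF int f]) simp
  also have "\<dots> = (\<integral>x\<in>A \<inter> C. real_cond_exp M F (indicator B) x \<partial>M)"
    unfolding set_lebesgue_integral_def by (simp add: indicator_inter_arith mult_ac)
  finally show "(\<integral>x\<in>A \<inter> C. real_cond_exp M F (indicator B) x \<partial>M) =
      (\<integral>x. ?f x * real_cond_exp M F (indicator A) x \<partial>M)" ..
qed

text \<open>Self-adjointness of conditional expectation: both sides are the integral over
  \<open>C\<close> of the product of the two conditional probabilities.\<close>

lemma (in finite_measure_subalgebra) cond_exp_indicator_swap:
  assumes "A \<in> sets M" "B \<in> sets M" "C \<in> sets F"
  shows "(\<integral>x\<in>A \<inter> C. real_cond_exp M F (indicator B) x \<partial>M) =
    (\<integral>x\<in>B \<inter> C. real_cond_exp M F (indicator A) x \<partial>M)"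
  unfolding cond_exp_indicator_mult(2)[OF assms] cond_exp_indicator_mult(2)[OF assms(2,1,3)]
  by (rule Bochner_Integration.integral_cong) simp_all

text \<open>Completing the square: the hypothesis makes the \<open>L\<^sup>2\<close> distance vanish.\<close>

lemma (in finite_measure_subalgebra) cond_exp_indicator_eq_indicator:
  assumes A: "A \<in> sets M"
    and eq: "(\<integral>x\<in>A. indicator A x \<partial>M) = (\<integral>x\<in>A. real_cond_exp M F (indicator A) x \<partial>M)"
  shows "AE x in M. real_cond_exp M F (indicator A) x = indicator A x"
proof -
  let ?p = "real_cond_exp M F (indicator A)"
  have \<Omega>: "space M \<in> sets F"
    using subalg sets.top[of F] by (simp add: subalgebra_def)
  have *: "(\<lambda>x. (indicator (space M) x :: real) * ?p x * indicator A x) = (\<lambda>x. ?p x * indicator A x)"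
    using sets.sets_into_space[OF A] by (auto simp: fun_eq_iff split: split_indicator)
  have pA: "integrable M (\<lambda>x. ?p x * indicator A x)"
    using integrable_cond_exp_indicator_mult_indicator[OF A A \<Omega>] unfolding * .
  have pp: "integrable M (\<lambda>x. ?p x * ?p x)"
    using cond_exp_indicator_mult(1)[OF A A \<Omega>] by (subst (asm) Bochner_Integration.integrable_cong[OF refl]) auto
  have iA: "integrable M (indicator A :: 'a \<Rightarrow> real)"
    using A by (simp add: less_top[symmetric])
  \<comment> \<open>The three terms of the expanded square reduce to the same number, the integral
    of \<open>?p\<close> over \<open>A\<close>: \<open>1\<close> by the averaging property with
    \<open>C = space M\<close>, \<open>2\<close> by definition, \<open>3\<close> by the hypothesis.
    With coefficients 1, -2, 1 they cancel.\<close>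
  have "A \<inter> space M = A" using sets.sets_into_space[OF A] by blast
  then have 1: "(\<integral>x. ?p x * ?p x \<partial>M) = (\<integral>x\<in>A. ?p x \<partial>M)"
    using cond_exp_indicator_mult(2)[OF A A \<Omega>] by (simp cong: Bochner_Integration.integral_cong)
  have 2: "(\<integral>x. ?p x * indicator A x \<partial>M) = (\<integral>x\<in>A. ?p x \<partial>M)"
    by (simp add: set_lebesgue_integral_def mult.commute)
  have 3: "(\<integral>x. indicator A x \<partial>M) = (\<integral>x\<in>A. ?p x \<partial>M)"
    unfolding eq[symmetric] by (simp add: set_lebesgue_integral_def indicator_inter_arith[symmetric])
  have sq: "(\<lambda>x. (?p x - indicator A x)\<^sup>2) =
      (\<lambda>x. ?p x * ?p x - 2 * (?p x * indicator A x) + indicator A x)"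
    by (auto simp: fun_eq_iff power2_eq_square algebra_simps split: split_indicator)
  have int: "integrable M (\<lambda>x. (?p x - indicator A x)\<^sup>2)"
    unfolding sq using pp pA iA by auto
  have "(\<integral>x. (?p x - indicator A x)\<^sup>2 \<partial>M) = 0"
    unfolding sq using pp pA iA 1 2 3 by simp
  then show ?thesis
    using integral_nonneg_eq_0_iff_AE[OF int] by simp
qed

text \<open>The level set where the conditional probability equals 1 is in \<open>F\<close> and
  differs from \<open>A\<close> only by null sets. Since \<open>F\<close> contains these,
  \<open>A\<close> is rebuilt from the level set inside \<open>F\<close>.\<close>

lemma (in finite_measure_subalgebra) mem_sets_of_cond_exp_eq:
  assumes A: "A \<in> sets M" and null: "null_sets M \<subseteq> sets F"
    and eq: "AE x in M. real_cond_exp M F (indicator A) x = indicator A x"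
  shows "A \<in> sets F"
proof -
  let ?p = "real_cond_exp M F (indicator A)"
  define B where "B = {x \<in> space F. ?p x = 1}"
  have B: "B \<in> sets F" unfolding B_def by measurable
  then have "B \<in> sets M" using subalg by (auto simp: subalgebra_def)
  have "space F = space M" using subalg by (simp add: subalgebra_def)
  have "AE x in M. x \<notin> A - B \<and> x \<notin> B - A"
    using eq AE_space
  proof eventually_elim
    case (elim x)
    then show ?case using \<open>space F = space M\<close> by (auto simp: B_def split: split_indicator_asm)
  qed
  then have "A - B \<in> null_sets M" "B - A \<in> null_sets M"
    using A \<open>B \<in> sets M\<close> by (auto simp: AE_iff_null_sets)
  then have "A - B \<in> sets F" "B - A \<in> sets F" using null by auto
  then have "(B - (B - A)) \<union> (A - B) \<in> sets F" using B by auto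
  moreover have "(B - (B - A)) \<union> (A - B) = A" by blast
  ultimately show ?thesis by simp
qed

section \<open>From conditional independence to the intersection of two joins\<close>

lemma cond_indep_fieldsD2:
  assumes ci: "cond_indep_fields M Z X I" and "a \<in> I" "b \<in> I" "a \<noteq> b" "A \<in> X a" "B \<in> X b"
  shows "AE w in M. cond_prob_given M Z (A \<inter> B) w = cond_prob_given M Z A w * cond_prob_given M Z B w"
proof -
  \<comment> \<open>Only the values at \<open>a\<close> and \<open>b\<close> matter, since the
    finite subfamily used is \<open>{a, b}\<close>.\<close>
  define S where "S = (\<lambda>j. if j = a then A else B)"
  have "S \<in> Pi {a, b} X" "{a, b} \<subseteq> I"
    using assms by (auto simp: S_def)
  then have "AE w in M. cond_prob_given M Z (\<Inter>j\<in>{a, b}. S j) w =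
      (\<Prod>j\<in>{a, b}. cond_prob_given M Z (S j) w)"
    using ci unfolding cond_indep_fields_def by blast
  moreover have "(\<Inter>j\<in>{a, b}. S j) = A \<inter> B"
    using \<open>a \<noteq> b\<close> by (auto simp: S_def)
  ultimately show ?thesis
    using \<open>a \<noteq> b\<close> by (simp add: S_def)
qed

lemma (in prob_space) null_sets_subset_trivial_events: "null_sets M \<subseteq> trivial_events M"
  by (auto simp: trivial_events_def measure_eq_0_null_sets)

text \<open>Independence passes from the fields to their joins with \<open>Z\<close> one side at a
  time: first \<open>X\<close> is enlarged against a fixed event of \<open>Y\<close>, then
  \<open>Y\<close> against a fixed event of the first join. That event may then be tested on
  itself.\<close>

lemma (in prob_space) field_joins_Int_subset:
  assumes Z: "Z \<in> complete_subfields M"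
    and X: "X \<in> complete_subfields M" and Y: "Y \<in> complete_subfields M"
    and ci: "\<And>A B. A \<in> X \<Longrightarrow> B \<in> Y \<Longrightarrow>
      AE w in M. cond_prob_given M Z (A \<inter> B) w = cond_prob_given M Z A w * cond_prob_given M Z B w"
  shows "field_join M X Z \<inter> field_join M Y Z \<subseteq> Z"
proof
  fix A assume A: "A \<in> field_join M X Z \<inter> field_join M Y Z"
  \<comment> \<open>This is the measure inside \<open>cond_prob_given\<close>, so conditional
    probabilities given \<open>Z\<close> are conditional expectations with respect to
    \<open>F\<close>.\<close>
  define F where "F = sigma (space M) Z"
  have "sigma_algebra (space M) Z" and "Z \<subseteq> sets M"
    using Z by (auto simp: complete_subfields_def)
  moreover have "Z \<subseteq> Pow (space M)"
    using \<open>Z \<subseteq> sets M\<close> sets.space_closed by blast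
  ultimately have sets_F: "sets F = Z" and "space F = space M"
    unfolding F_def by (simp_all add: sigma_algebra.sigma_sets_eq)
  interpret finite_measure_subalgebra M F
    by standard (simp add: subalgebra_def sets_F \<open>space F = space M\<close> \<open>Z \<subseteq> sets M\<close>)
  let ?p = "\<lambda>A. real_cond_exp M F (indicator A)"
  have meas: "B \<in> sets M" if "B \<in> X \<or> B \<in> Y \<or> B \<in> Z" for B
    using that X Y Z by (auto simp: complete_subfields_def)
  have iind: "integrable M (indicator B :: 'a \<Rightarrow> real)" if "B \<in> sets M" for B
    using that by (simp add: less_top[symmetric])
  have ip: "integrable M (?p B)" if "B \<in> sets M" for B
    using iind[OF that] by (rule real_cond_exp_int(1))

  \<comment> \<open>In other words, the conditional probability of \<open>B\<close> given the join
    of \<open>X\<close> and \<open>Z\<close> is already the one given \<open>Z\<close>.\<close>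
  have one: "(\<integral>x\<in>E. indicator B x \<partial>M) = (\<integral>x\<in>E. ?p B x \<partial>M)"
    if E: "E \<in> field_join M X Z" and B: "B \<in> Y" for E B
  proof (rule set_integral_eq_on_field_join[OF _ _ X Z _ E])
    show "integrable M (indicator B :: 'a \<Rightarrow> real)" "integrable M (?p B)"
      using B meas by (auto intro: iind ip)
    fix D C assume D: "D \<in> X" and C: "C \<in> Z"
    have DB: "D \<inter> B \<in> sets M" using D B meas by blast
    have "(\<integral>x\<in>D \<inter> C. indicator B x \<partial>M) = (\<integral>x\<in>C. indicator (D \<inter> B) x \<partial>M :: real)"
      unfolding set_lebesgue_integral_def by (simp add: indicator_inter_arith mult_ac)
    also have "\<dots> = (\<integral>x\<in>C. ?p (D \<inter> B) x \<partial>M)"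
      using C by (intro real_cond_exp_intA iind DB) (simp add: sets_F)
    also have "\<dots> = (\<integral>x. indicator C x * ?p B x * ?p D x \<partial>M)"
      unfolding set_lebesgue_integral_def
    proof (rule integral_cong_AE)
      \<comment> \<open>Here the assumed factorisation enters; the other equalities of the chain are
        general facts about conditional expectation.\<close>
      show "AE x in M. indicator C x *\<^sub>R ?p (D \<inter> B) x = indicator C x * ?p B x * ?p D x"
        using ci[OF D B] unfolding cond_prob_given_def F_def[symmetric] by eventually_elim simp
    qed (use C meas in simp_all)
    also have "\<dots> = (\<integral>x\<in>D \<inter> C. ?p B x \<partial>M)"
      using C D B meas by (intro cond_exp_indicator_mult(2)[symmetric]) (auto simp: sets_F)
    finally show "(\<integral>x\<in>D \<inter> C. indicator B x \<partial>M) = (\<integral>x\<in>D \<inter> C. ?p B x \<partial>M)" .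
  qed

  have A_M: "A \<in> sets M"
    using A field_join_subset_sets[OF X Z] by blast
  \<comment> \<open>Now \<open>A\<close> is the fixed event, taken from the first join, while the
    integration set varies over the second join; since \<open>A\<close> lies there too, it may be
    that set.\<close>
  have "(\<integral>x\<in>A. indicator A x \<partial>M) = (\<integral>x\<in>A. ?p A x \<partial>M)"
  proof (rule set_integral_eq_on_field_join[OF iind ip Y Z])
    fix B C assume B: "B \<in> Y" and C: "C \<in> Z"
    \<comment> \<open>Both sides are the probability of the triple intersection. Exchanging
      \<open>A\<close> and \<open>B\<close> puts the event of \<open>Y\<close> in the integrand, as
      \<open>one\<close> requires; the swap lemma afterwards exchanges them back.\<close>
    have "(\<integral>x\<in>B \<inter> C. indicator A x \<partial>M) = (\<integral>x\<in>A \<inter> C. indicator B x \<partial>M :: real)"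
      unfolding set_lebesgue_integral_def by (simp add: indicator_inter_arith mult_ac)
    also have "\<dots> = (\<integral>x\<in>A \<inter> C. ?p B x \<partial>M)"
      using A C B by (intro one field_join_Int_right[OF X Z]) auto
    also have "\<dots> = (\<integral>x\<in>B \<inter> C. ?p A x \<partial>M)"
      using A_M B C meas by (intro cond_exp_indicator_swap) (auto simp: sets_F)
    finally show "(\<integral>x\<in>B \<inter> C. indicator A x \<partial>M) = (\<integral>x\<in>B \<inter> C. ?p A x \<partial>M)" .
  qed (use A A_M in auto)
  then have "AE x in M. ?p A x = indicator A x"
    by (rule cond_exp_indicator_eq_indicator[OF A_M])
  \<comment> \<open>Completeness of \<open>Z\<close> is used here: null events have probability
    0.\<close>
  moreover have "null_sets M \<subseteq> sets F"
    using null_sets_subset_trivial_events Z by (auto simp: sets_F complete_subfields_def)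
  ultimately show "A \<in> Z"
    using mem_sets_of_cond_exp_eq[OF A_M] by (simp add: sets_F)
qed

theorem proposition3p21:
  fixes M :: "'a measure"
    and I :: "'i set"
    and X :: "'i \<Rightarrow> 'a set set"
    and Z :: "'a set set"
  assumes "prob_space M"
    and "\<exists>a\<in>I. \<exists>b\<in>I. a \<noteq> b"
    and "Z \<in> complete_subfields M"
    and "\<And>\<alpha>. \<alpha> \<in> I \<Longrightarrow> X \<alpha> \<in> complete_subfields M"
    and "cond_indep_fields M Z X I"
  shows "Z = (\<Inter>\<alpha>\<in>I. field_join M (X \<alpha>) Z) \<and> (\<Inter>\<alpha>\<in>I. X \<alpha>) \<subseteq> Z"
proof -
  interpret prob_space M by fact
  obtain a b where ab: "a \<in> I" "b \<in> I" "a \<noteq> b"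
    using assms(2) by blast
  \<comment> \<open>The intersection over all indices lies in that of any two joins, so one distinct
    pair gives the upper bound.\<close>
  have "field_join M (X a) Z \<inter> field_join M (X b) Z \<subseteq> Z"
    using assms(3,4) ab cond_indep_fieldsD2[OF assms(5) ab] by (intro field_joins_Int_subset) auto
  \<comment> \<open>The inclusion of \<open>Z\<close> gives the reverse bound; that of
    \<open>X \<alpha>\<close> reduces the second claim to the first.\<close>
  moreover have "X \<alpha> \<union> Z \<subseteq> field_join M (X \<alpha>) Z" for \<alpha>
    unfolding field_join_def by blast
  ultimately show ?thesis
    using ab by blast
qed

end
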